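(* Let $A$ be an alphabet and let $X \subseteq A^+$ be a thin code. Then $X$ is complete if and only if $X$ is maximal.
   Context: $A^*$ is the monoid of finite words over $A$ under concatenation, with empty word $1$; $A^+ = A^*\setminus\{1\}$. A code is any subset $X \subseteq A^+$ (not necessarily uniquely decipherable); $X^*$ is the submonoid of $A^*$ generated by $X$. A word $w$ is a factor of $z$ if $z = uwv$ for some $u,v\in A^*$; for $X\subseteq A^*$, $F(X)$ is the set of factors of words in $X$. A set $X \subseteq A^*$ is dense if $F(X) = A^*$, thin if it is not dense, and complete if $X^*$ is dense. Free product: let $N$ be a monoid generated by submonoids $M$ and $L$. An expression $m_1 m_2\cdots m_r$ ($r\ge 0$) of an element of $N$ is in reduced form with respect to $M, L$ if each $m_i \neq 1$, each $m_i$ belongs to $M$ or $L$, and consecutive factors are taken from different ones of the two submonoids. One writes $N = M * L$ if $N$ is generated by $M\cup L$ and every element of $N$ has a unique expression in reduced form with respect to $M, L$ ($L$ may be trivial). For submonoids $M, N$ of $A^*$, $M \preceq N$ means that there is a submonoid $L \subseteq A^*$ with $N = M * L$. This is a partial order on the submonoids of $A^*$. A submonoid of $A^*$ is full if it is maximal with respect to $\preceq$. A code $X\subseteq A^+$ is maximal if the monoid $X^*$ is full. *)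

theory Defs
  imports HOL.Hull "HOL-Library.Sublist"
begin

text \<open>
  The alphabet is an arbitrary set \<open>A\<close> of letters (neither finiteness nor nonemptiness is
  required); \<open>lists A\<close> is the free monoid of words over \<open>A\<close>, with concatenation \<open>(@)\<close> and
  empty word \<open>[]\<close>.
\<close>

definition submonoid_of :: "'a set \<Rightarrow> 'a list set \<Rightarrow> bool" where
  "submonoid_of A M \<longleftrightarrow> M \<subseteq> lists A \<and> [] \<in> M \<and> (\<forall>u\<in>M. \<forall>v\<in>M. u @ v \<in> M)"

definition star :: "'a list set \<Rightarrow> 'a list set" where
  "star X = concat ` lists X"

lemma star_eq_hull:
  assumes "X \<subseteq> lists A"
  shows "star X = submonoid_of A hull X"
proof (rule hull_unique[symmetric])
  show "X \<subseteq> star X"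
  proof
    fix x assume "x \<in> X"
    then have "concat [x] \<in> star X"
      unfolding star_def by (intro imageI) simp
    then show "x \<in> star X" by simp
  qed
  have "u @ v \<in> star X" if "u \<in> star X" "v \<in> star X" for u v
  proof -
    from that obtain us vs where "us \<in> lists X" "vs \<in> lists X" "u = concat us" "v = concat vs"
      unfolding star_def by blast
    then have "u @ v = concat (us @ vs)" "us @ vs \<in> lists X" by auto
    then show ?thesis unfolding star_def by blast
  qed
  moreover have "star X \<subseteq> lists A" using assms by (fastforce simp: star_def)
  moreover have "[] \<in> star X" unfolding star_def by (rule image_eqI[of _ _ "[]"]) simp_all
  ultimately show "submonoid_of A (star X)" by (simp add: submonoid_of_def)
next
  fix M assume "X \<subseteq> M" and M: "submonoid_of A M"
  have "concat ws \<in> M" if "ws \<in> lists X" for ws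
    using that \<open>X \<subseteq> M\<close> M by (induction ws) (auto simp: submonoid_of_def)
  then show "star X \<subseteq> M" by (auto simp: star_def)
qed

definition factors :: "'a list set \<Rightarrow> 'a list set" where
  "factors X = {w. \<exists>z\<in>X. sublist w z}"

definition dense :: "'a set \<Rightarrow> 'a list set \<Rightarrow> bool" where
  "dense A X \<longleftrightarrow> factors X = lists A"

definition thin :: "'a set \<Rightarrow> 'a list set \<Rightarrow> bool" where
  "thin A X \<longleftrightarrow> \<not> dense A X"

definition complete :: "'a set \<Rightarrow> 'a list set \<Rightarrow> bool" where
  "complete A X \<longleftrightarrow> dense A (star X)"

text \<open>Not necessarily uniquely decipherable.\<close>

definition code :: "'a set \<Rightarrow> 'a list set \<Rightarrow> bool" where
  "code A X \<longleftrightarrow> X \<subseteq> lists A - {[]}"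

text \<open>
  \<open>alternating M L [m\<^sub>1, \<dots>, m\<^sub>r]\<close>: no \<open>m\<^sub>i\<close> is empty, and \<open>m\<^sub>1, m\<^sub>2, m\<^sub>3, \<dots>\<close> are taken from
  \<open>M, L, M, \<dots>\<close> in turn.
\<close>

fun alternating :: "'a list set \<Rightarrow> 'a list set \<Rightarrow> 'a list list \<Rightarrow> bool" where
  "alternating M L [] \<longleftrightarrow> True"
| "alternating M L (m # ms) \<longleftrightarrow> m \<noteq> [] \<and> m \<in> M \<and> alternating L M ms"

definition reduced_form :: "'a list set \<Rightarrow> 'a list set \<Rightarrow> 'a list list \<Rightarrow> bool" where
  "reduced_form M L ms \<longleftrightarrow> alternating M L ms \<or> alternating L M ms"

text \<open>\<open>is_free_product N M L\<close> is the relation \<open>N = M * L\<close>, for submonoids \<open>M\<close>, \<open>L\<close> of \<open>lists A\<close>.\<close>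

definition is_free_product :: "'a list set \<Rightarrow> 'a list set \<Rightarrow> 'a list set \<Rightarrow> bool" where
  "is_free_product N M L \<longleftrightarrow>
     N = star (M \<union> L) \<and> (\<forall>z\<in>N. \<exists>!ms. reduced_form M L ms \<and> concat ms = z)"

definition free_factor :: "'a set \<Rightarrow> 'a list set \<Rightarrow> 'a list set \<Rightarrow> bool" where
  "free_factor A M N \<longleftrightarrow>
     submonoid_of A M \<and> submonoid_of A N \<and> (\<exists>L. submonoid_of A L \<and> is_free_product N M L)"

text \<open>Maximality among the submonoids of \<open>lists A\<close> for the partial order \<open>free_factor A\<close>.\<close>

definition full :: "'a set \<Rightarrow> 'a list set \<Rightarrow> bool" where
  "full A M \<longleftrightarrow> submonoid_of A M \<and> (\<forall>N. free_factor A M N \<longrightarrow> N = M)"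

definition maximal_code :: "'a set \<Rightarrow> 'a list set \<Rightarrow> bool" where
  "maximal_code A X \<longleftrightarrow> code A X \<and> full A (star X)"

end

theory Submission
  imports Complex_Main Defs
begin

text \<open>
  Let \<open>M = star X\<close>.

  If \<open>M\<close> is not complete, pick a word \<open>w\<close> that is not a factor of \<open>M\<close> and a letter \<open>b\<close> other than
  the first letter of \<open>w\<close>. The word \<open>y = w b\<^sup>n\<close>, \<open>n = |w|\<close>, is unbordered and not a factor of \<open>M\<close>,
  so the occurrences of \<open>y\<close> in a product of elements of \<open>M\<close> and powers of \<open>y\<close> are exactly the
  visible ones, and \<open>M\<close> is a proper free factor of the monoid generated by \<open>M\<close> and \<open>y\<close>.
  (Over a one-letter alphabet \<open>M\<close> is trivial, and a free factor of every submonoid.)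

  Conversely, let \<open>M\<close> be complete and \<open>N = M * L\<close> with \<open>1 \<noteq> l \<in> L\<close>. The words \<open>m l\<close>, \<open>1 \<noteq> m \<in> M\<close>,
  form a uniquely decipherable code, so by the Kraft-McMillan inequality the sum of \<open>q\<^sup>-\<^sup>|\<^sup>m\<^sup>|\<close> over
  the \<open>m \<in> M\<close> written with a given set of \<open>q\<close> letters that contains the letters of \<open>l\<close> is finite.
  But if \<open>w\<close> is not a factor of \<open>X\<close>, then completeness yields for every word \<open>z\<close> a suffix \<open>p\<close> and a
  prefix \<open>s\<close> of \<open>w\<close> with \<open>p z s \<in> M\<close>; as there are only finitely many pairs \<open>(p, s)\<close>, that sum
  diverges.
\<close>

section \<open>Submonoids and reduced forms\<close>

lemma star_incl: "x \<in> X \<Longrightarrow> x \<in> star X"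
  unfolding star_def by (rule image_eqI[of _ _ "[x]"]) auto

lemma Nil_in_star: "[] \<in> star X"
  unfolding star_def by (rule image_eqI[of _ _ "[]"]) auto

lemma star_append:
  assumes "u \<in> star X" "v \<in> star X"
  shows "u @ v \<in> star X"
proof -
  obtain us vs where "us \<in> lists X" "vs \<in> lists X" "u = concat us" "v = concat vs"
    using assms unfolding star_def by blast
  then show ?thesis unfolding star_def by (intro image_eqI[of _ _ "us @ vs"]) auto
qed

lemma submonoid_of_star:
  assumes "X \<subseteq> lists A"
  shows "submonoid_of A (star X)"
proof -
  have "star X \<subseteq> lists A" using assms by (fastforce simp: star_def)
  then show ?thesis by (simp add: submonoid_of_def Nil_in_star star_append)
qed

lemma star_submonoid: "submonoid_of A M \<Longrightarrow> star M = M"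
  by (metis star_eq_hull hull_same submonoid_of_def)

lemma star_singleton: "star {y} = {concat (replicate k y) | k. True}"
proof -
  have "lists {y} = {replicate k y | k. True}"
    by (auto simp: in_lists_conv_set) (metis replicate_length_same)
  then show ?thesis by (auto simp: star_def)
qed

lemma reduced_form_commute: "reduced_form M L ms \<longleftrightarrow> reduced_form L M ms"
  by (auto simp: reduced_form_def)

lemma reduced_form_concat_Nil:
  assumes "reduced_form M L ms" "concat ms = []"
  shows "ms = []"
proof (cases ms)
  case (Cons m r)
  then have "m \<noteq> []" using assms(1) by (auto simp: reduced_form_def)
  then show ?thesis using assms(2) Cons by simp
qed

text \<open>A nonempty \<open>x\<close> becomes a new first factor or, if \<open>ms\<close> already
  starts in \<open>M\<close>, is merged into its first factor.\<close>

lemma reduced_form_Cons: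
  assumes "submonoid_of A M" "x \<in> M" "reduced_form M L ms"
  shows "\<exists>ms'. reduced_form M L ms' \<and> concat ms' = x @ concat ms"
proof (cases "x = []")
  case True
  then show ?thesis using assms(3) by auto
next
  case False
  show ?thesis
  proof (cases "alternating L M ms")
    case True
    then have "reduced_form M L (x # ms)" using False assms(2) by (simp add: reduced_form_def)
    then show ?thesis by (metis concat.simps(2))
  next
    case not: False
    then obtain m r where ms: "ms = m # r" by (cases ms) auto
    then have "m \<in> M" "alternating L M r" using not assms(3) by (auto simp: reduced_form_def)
    then have "reduced_form M L ((x @ m) # r)"
      using False assms by (simp add: reduced_form_def submonoid_of_def)
    then show ?thesis using ms by (metis append_assoc concat.simps(2))
  qed
qed

lemma reduced_form_exists:
  assumes "submonoid_of A M" "submonoid_of A L" "z \<in> star (M \<union> L)"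
  shows "\<exists>ms. reduced_form M L ms \<and> concat ms = z"
proof -
  obtain xs where "xs \<in> lists (M \<union> L)" "z = concat xs" using assms(3) by (auto simp: star_def)
  moreover have "\<exists>ms. reduced_form M L ms \<and> concat ms = concat xs" if "xs \<in> lists (M \<union> L)" for xs
    using that
  proof (induction xs)
    case Nil
    then show ?case by (intro exI[of _ "[]"]) (simp add: reduced_form_def)
  next
    case (Cons x xs)
    then obtain ms where "reduced_form M L ms" "concat ms = concat xs" by auto
    then show ?case
      using Cons.hyps(1) reduced_form_Cons[OF assms(1), of x L ms]
        reduced_form_Cons[OF assms(2), of x M ms] by (auto simp: reduced_form_commute)
  qed
  ultimately show ?thesis by blast
qed

lemma is_free_product_I:
  assumes "submonoid_of A M" "submonoid_of A L"
    and "\<And>ms ms'. reduced_form M L ms \<Longrightarrow> reduced_form M L ms' \<Longrightarrow> concat ms = concat ms' \<Longrightarrow> ms = ms'"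
  shows "is_free_product (star (M \<union> L)) M L"
  unfolding is_free_product_def
proof (intro conjI ballI refl)
  fix z assume "z \<in> star (M \<union> L)"
  then obtain ms where "reduced_form M L ms" "concat ms = z"
    using reduced_form_exists[OF assms(1,2)] by blast
  then show "\<exists>!ms. reduced_form M L ms \<and> concat ms = z" using assms(3) by blast
qed

section \<open>Adjoining an unbordered word\<close>

definition unbordered :: "'a list \<Rightarrow> bool" where
  "unbordered y \<longleftrightarrow> (\<forall>u. prefix u y \<longrightarrow> suffix u y \<longrightarrow> u = [] \<or> u = y)"

text \<open>A nontrivial border \<open>u\<close> begins with \<open>a\<close> and is a suffix of the
  word without its first letter, so it has fewer \<open>a\<close>s than the whole word. Hence it
  cannot contain \<open>a # w\<close>, where all the \<open>a\<close>s lie, and is short enough to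
  be a suffix of the block of \<open>b\<close>s.\<close>

lemma unbordered_append_replicate:
  assumes "b \<noteq> a"
  shows "unbordered ((a # w) @ replicate (Suc (length w)) b)" (is "unbordered ?y")
  unfolding unbordered_def
proof (intro allI impI)
  fix u assume pre: "prefix u ?y" and suf: "suffix u ?y"
  show "u = [] \<or> u = ?y"
  proof (rule ccontr)
    assume *: "\<not> (u = [] \<or> u = ?y)"
    then obtain u' where u: "u = a # u'" using pre by (cases u) auto
    from suf * have "suffix u (w @ replicate (Suc (length w)) b)" by (auto simp: suffix_Cons)
    then have "count_list u a \<le> count_list (w @ replicate (Suc (length w)) b) a"
      by (metis suffix_def count_list_append le_add2)
    then have less: "count_list u a < count_list ?y a" by simp
    have "length u \<le> Suc (length w)"
    proof (rule ccontr)
      assume "\<not> ?thesis"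
      then have "prefix (a # w) u" using pre
        by (metis length_Cons linorder_le_cases prefix_length_prefix prefixI)
      then have "count_list (a # w) a \<le> count_list u a" by (auto simp: prefix_def)
      moreover have "count_list ?y a = count_list (a # w) a" using assms
        by (simp add: count_list_0_iff)
      ultimately show False using less by linarith
    qed
    then have "suffix u (replicate (Suc (length w)) b)"
      using suf by (metis length_replicate suffixI suffix_length_suffix)
    then have "set u \<subseteq> {b}" by (metis set_mono_suffix set_replicate_Suc)
    then show False using u assms by auto
  qed
qed

text \<open>Let \<open>d\<close> be the shift between the two occurrences. If it is at least as long
  as \<open>y\<close>, the first \<open>y\<close> lies inside \<open>m'\<close>; otherwise the
  occurrences overlap in a nonempty border \<open>u\<close>, which must be all of
  \<open>y\<close>.\<close>

lemma unbordered_occurrence_le: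
  assumes "unbordered y" "y \<noteq> []" "\<not> sublist y m'" "length m \<le> length m'" "m @ y @ r = m' @ y @ r'"
  shows "m = m'"
proof -
  have "prefix m m'" using assms(4,5) by (metis prefixI prefix_length_prefix)
  then obtain d where d: "m' = m @ d" "y @ r = d @ y @ r'"
    using assms(5) by (auto elim: prefixE)
  have "length d < length y"
  proof (rule ccontr)
    assume "\<not> ?thesis"
    then have "prefix y d" using d(2) by (metis prefixI prefix_length_prefix not_less)
    then show False using d(1) assms(3) by (auto simp: prefix_def sublist_def)
  qed
  have "prefix d (y @ r)" unfolding d(2) by simp
  then have "prefix d y" using prefix_length_prefix[of d "y @ r" y] \<open>length d < length y\<close> by simp
  then obtain u where u: "y = d @ u" "u @ r = y @ r'"
    using d(2) by (auto elim: prefixE)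
  have "length u \<le> length y" unfolding u(1) by simp
  moreover have "prefix u (y @ r')" unfolding u(2)[symmetric] by simp
  ultimately have "prefix u y" using prefix_length_prefix[of u "y @ r'" y] by simp
  moreover have "suffix u y" unfolding u(1) by (simp add: suffix_def)
  moreover have "u \<noteq> []" using u(1) \<open>length d < length y\<close> by auto
  ultimately have "u = y" using assms(1) unfolding unbordered_def by blast
  then have "d = []" using u(1) by (metis append_self_conv2)
  then show ?thesis using d(1) by simp
qed

lemma unbordered_occurrence:
  assumes "unbordered y" "y \<noteq> []" "\<not> sublist y m" "\<not> sublist y m'" "m @ y @ r = m' @ y @ r'"
  shows "m = m'"
proof (cases "length m \<le> length m'")
  case True
  show ?thesis by (rule unbordered_occurrence_le[OF assms(1,2,4) True assms(5)])
next
  case False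
  then have le: "length m' \<le> length m" by simp
  show ?thesis by (rule unbordered_occurrence_le[OF assms(1-3) le assms(5)[symmetric], symmetric])
qed

context
  fixes y :: "'a list" and M :: "'a list set"
  assumes unb: "unbordered y" and nonempty: "y \<noteq> []" and notfac: "y \<notin> factors M" and one: "[] \<in> M"
begin

lemma not_sublist_M: "m \<in> M \<Longrightarrow> \<not> sublist y m"
  using notfac by (auto simp: factors_def)

lemma alternating_star_starts:
  assumes "alternating (star {y}) M ms" "ms \<noteq> []"
  shows "\<exists>t. concat ms = y @ t"
proof -
  obtain k ms' where "ms = concat (replicate k y) # ms'" "concat (replicate k y) \<noteq> []"
    using assms by (cases ms) (auto simp: star_singleton)
  then show ?thesis by (cases k) auto
qed

text \<open>An initial \<open>y\<close> would lie inside a lone factor \<open>m\<close>, or else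
  compete with the \<open>y\<close> right after \<open>m\<close>; comparing the occurrences after
  \<open>[]\<close> and after \<open>m\<close> would make \<open>m\<close> empty. So an initial
  \<open>y\<close> tells the two types of reduced form apart.\<close>

lemma alternating_M_not_starts:
  assumes "alternating M (star {y}) ms"
  shows "concat ms \<noteq> y @ t"
proof
  assume eq: "concat ms = y @ t"
  then obtain m r where ms: "ms = m # r" using nonempty by (cases ms) auto
  then have m: "m \<in> M" "m \<noteq> []" and r: "alternating (star {y}) M r" using assms by auto
  show False
  proof (cases "r = []")
    case True
    then show False using eq ms not_sublist_M[OF m(1)] by (auto simp: sublist_def)
  next
    case False
    then obtain t' where "concat r = y @ t'" using alternating_star_starts r by blast
    then have "m @ y @ t' = [] @ y @ t" using eq ms by simp
    then show False
      using unbordered_occurrence[OF unb nonempty not_sublist_M not_sublist_M] m one by metis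
  qed
qed

text \<open>The first factor is what precedes the first visible \<open>y\<close>, or the whole word
  if there is none; the two cases exclude each other because no element of \<open>M\<close> contains
  \<open>y\<close>.\<close>

lemma alternating_M_head_unique:
  assumes "alternating M (star {y}) (m # r)" "alternating M (star {y}) (m' # r')"
    "m @ concat r = m' @ concat r'"
  shows "m = m'"
proof -
  have m: "\<not> sublist y m" "\<not> sublist y m'" using assms(1,2) not_sublist_M by auto
  have starts: "r \<noteq> [] \<Longrightarrow> \<exists>t. concat r = y @ t" "r' \<noteq> [] \<Longrightarrow> \<exists>t. concat r' = y @ t"
    using assms(1,2) alternating_star_starts by auto
  consider "r = []" "r' = []" | t where "r = []" "concat r' = y @ t"
    | t where "r' = []" "concat r = y @ t" | t t' where "concat r = y @ t" "concat r' = y @ t'"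
    using starts by blast
  then show ?thesis
  proof cases
    case 1
    then show ?thesis using assms(3) by simp
  next
    case 2
    then show ?thesis using assms(3) m by (auto simp: sublist_def)
  next
    case 3
    then show ?thesis using assms(3) m by (auto simp: sublist_def)
  next
    case 4
    then show ?thesis using assms(3) unbordered_occurrence[OF unb nonempty m] by metis
  qed
qed

text \<open>Otherwise cancelling \<open>k\<close> copies of \<open>y\<close> would leave
  \<open>concat r\<close> with an initial \<open>y\<close>. So a first factor from
  \<open>star {y}\<close> is the largest power of \<open>y\<close> with which the word
  begins.\<close>

lemma star_power_le:
  assumes "alternating M (star {y}) r"
    and "concat (replicate k y) @ concat r = concat (replicate j y) @ t"
  shows "j \<le> k"
proof (rule ccontr)
  assume "\<not> j \<le> k"
  then obtain d where "j = k + Suc d" using that[of "j - Suc k"] by simp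
  then have "concat (replicate j y) = concat (replicate k y) @ y @ concat (replicate d y)"
    by (simp only: replicate_add concat_append replicate_Suc concat.simps)
  then have "concat r = y @ concat (replicate d y) @ t"
    using assms(2) by simp
  then show False using alternating_M_not_starts assms(1) by metis
qed

lemma alternating_star_head_unique:
  assumes "alternating (star {y}) M (x # r)" "alternating (star {y}) M (x' # r')"
    "x @ concat r = x' @ concat r'"
  shows "x = x'"
proof -
  obtain k k' where k: "x = concat (replicate k y)" "x' = concat (replicate k' y)"
    using assms(1,2) by (auto simp: star_singleton)
  have "k' \<le> k" using star_power_le[of r k k' "concat r'"] assms k by auto
  moreover have "k \<le> k'" using star_power_le[of r' k' k "concat r"] assms(1,2) assms(3)[symmetric] k by auto
  ultimately show ?thesis using k by simp
qed

lemma reduced_form_unique: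
  assumes "reduced_form M (star {y}) ms" "reduced_form M (star {y}) ms'" "concat ms = concat ms'"
  shows "ms = ms'"
  using assms
proof (induction ms arbitrary: ms')
  case Nil
  then show ?case using reduced_form_concat_Nil[OF Nil.prems(2)] by simp
next
  case (Cons m r)
  have "ms' \<noteq> []" using reduced_form_concat_Nil[OF Cons.prems(1)] Cons.prems(3) by auto
  then obtain m' r' where ms': "ms' = m' # r'" by (cases ms') auto
  have eq: "m @ concat r = m' @ concat r'" using Cons.prems(3) ms' by simp
  have tails: "reduced_form M (star {y}) r" "reduced_form M (star {y}) r'"
    using Cons.prems ms' by (auto simp: reduced_form_def)
  consider "alternating M (star {y}) (m # r)" "alternating M (star {y}) (m' # r')"
    | "alternating (star {y}) M (m # r)" "alternating (star {y}) M (m' # r')"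
    | "alternating M (star {y}) (m # r)" "alternating (star {y}) M (m' # r')"
    | "alternating (star {y}) M (m # r)" "alternating M (star {y}) (m' # r')"
    using Cons.prems(1,2) ms' unfolding reduced_form_def by blast
  then have "m = m'"
  proof cases
    case 1
    then show ?thesis using alternating_M_head_unique eq by blast
  next
    case 2
    then show ?thesis using alternating_star_head_unique eq by blast
  next
    case 3
    then show ?thesis
      using alternating_M_not_starts alternating_star_starts Cons.prems(3) ms' by (metis list.distinct(1))
  next
    case 4
    then show ?thesis
      using alternating_M_not_starts alternating_star_starts Cons.prems(3) ms' by (metis list.distinct(1))
  qed
  moreover have "r = r'" using Cons.IH[OF tails] eq \<open>m = m'\<close> by simp
  ultimately show ?case using ms' by simp
qed

end

section \<open>Full submonoids are dense\<close>

lemma full_trivial_submonoid: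
  assumes "full A {[]}"
  shows "lists A = {[]}"
proof -
  have sub: "submonoid_of A {[]}" "submonoid_of A (lists A)" by (auto simp: submonoid_of_def)
  \<comment> \<open>No nonempty factor comes from \<open>{[]}\<close>, so alternation allows at most
    one factor.\<close>
  have short: "ms = (if concat ms = [] then [] else [concat ms])" if "reduced_form {[]} (lists A) ms" for ms
    using that by (cases ms; cases "tl ms") (auto simp: reduced_form_def)
  then have "is_free_product (star ({[]} \<union> lists A)) {[]} (lists A)"
    by (intro is_free_product_I[OF sub]) metis
  moreover have "{[]} \<union> lists A = lists A" by auto
  ultimately have "free_factor A {[]} (lists A)"
    using sub star_submonoid[OF sub(2)] unfolding free_factor_def by auto
  then show ?thesis using assms by (auto simp: full_def)
qed

lemma full_imp_dense:
  assumes "full A M"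
  shows "dense A M"
proof (rule ccontr)
  assume nd: "\<not> dense A M"
  have M: "submonoid_of A M" using assms by (simp add: full_def)
  then have "factors M \<subseteq> lists A" by (auto simp: factors_def submonoid_of_def dest: set_mono_sublist)
  then obtain w where w: "w \<in> lists A" "w \<notin> factors M" using nd by (auto simp: dense_def)
  then have "w \<noteq> []" using M by (auto simp: factors_def submonoid_of_def)
  then obtain a w' where aw: "w = a # w'" by (cases w) auto
  show False
  proof (cases "\<exists>b\<in>A. b \<noteq> a")
    case True
    then obtain b where b: "b \<in> A" "b \<noteq> a" by blast
    \<comment> \<open>Since \<open>length w = Suc (length w')\<close>, this is \<open>w\<close>
      followed by \<open>length w\<close> copies of \<open>b\<close>.\<close>
    define y where "y = (a # w') @ replicate (Suc (length w')) b"
    have y: "unbordered y" "y \<noteq> []" "y \<in> lists A"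
      using unbordered_append_replicate[OF b(2)] b(1) w(1) aw by (auto simp: y_def)
    have "sublist w y" using aw by (auto simp: y_def sublist_def)
    then have nf: "y \<notin> factors M" using w(2) by (auto simp: factors_def intro: sublist_order.order.trans)
    have L: "submonoid_of A (star {y})" using submonoid_of_star[of "{y}"] y(3) by simp
    have "is_free_product (star (M \<union> star {y})) M (star {y})"
      using reduced_form_unique[OF y(1,2) nf] M
      by (intro is_free_product_I[OF M L]) (auto simp: submonoid_of_def)
    moreover have "submonoid_of A (star (M \<union> star {y}))"
      using M L by (intro submonoid_of_star) (auto simp: submonoid_of_def)
    ultimately have "star (M \<union> star {y}) = M"
      using assms M L by (auto simp: full_def free_factor_def)
    then have "y \<in> M" by (metis UnI2 insertI1 star_incl)
    then show False using nf by (auto simp: factors_def)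
  next
    \<comment> \<open>All words are powers of \<open>a\<close> here, so a nonempty \<open>m\<close>
      in \<open>M\<close> would have a power at least as long as \<open>w\<close>, and that power
      would contain \<open>w\<close>.\<close>
    case False
    then have unary: "set z \<subseteq> {a}" if "z \<in> lists A" for z using that by (auto simp: in_lists_conv_set)
    have "m = []" if "m \<in> M" for m
    proof (rule ccontr)
      assume "m \<noteq> []"
      define p where "p = concat (replicate (length w) m)"
      have "concat (replicate k m) \<in> M" for k
        using M that by (induction k) (auto simp: submonoid_of_def)
      then have pM: "p \<in> M" by (simp add: p_def)
      have "length w * 1 \<le> length w * length m" using \<open>m \<noteq> []\<close> by (intro mult_left_mono) (auto simp: Suc_le_eq)
      also have "\<dots> = length p" by (simp add: p_def length_concat sum_list_replicate)
      finally have len: "length w \<le> length p" by simp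
      have rep: "z = replicate (length z) a" if "z \<in> lists A" for z
        using unary[OF that] by (metis replicate_length_same singletonD subsetD)
      have "p = replicate (length w + (length p - length w)) a"
        using rep[of p] pM M len by (auto simp: submonoid_of_def)
      then have "p = w @ replicate (length p - length w) a"
        using rep[OF w(1)] by (metis replicate_add)
      then have "sublist w p" by (metis append_Nil sublist_def)
      then show False using pM w(2) by (auto simp: factors_def)
    qed
    then have "M = {[]}" using M by (auto simp: submonoid_of_def)
    then show False using full_trivial_submonoid assms w(1) \<open>w \<noteq> []\<close> by auto
  qed
qed

section \<open>The Kraft-McMillan inequality\<close>

text \<open>The weight of a word is its probability when letters are drawn independently and
  uniformly from \<open>B\<close>.\<close>

lemma sum_words_length:
  assumes "finite B" "B \<noteq> {}"
  shows "(\<Sum>z\<in>{z \<in> lists B. length z = n}. (1 / real (card B)) ^ length z) = 1"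
proof -
  have "{z \<in> lists B. length z = n} = {z. set z \<subseteq> B \<and> length z = n}" by auto
  then have "(\<Sum>z\<in>{z \<in> lists B. length z = n}. (1 / real (card B)) ^ length z)
      = real (card B ^ n) * (1 / real (card B)) ^ n"
    using card_lists_length_eq[OF assms(1)] by simp
  also have "\<dots> = 1" using assms by (simp add: power_divide)
  finally show ?thesis .
qed

lemma finite_words_le: "finite B \<Longrightarrow> finite {z \<in> lists B. length z \<le> n}"
  using finite_lists_length_le[of B n] by (simp add: lists_eq_set)

lemma sum_words_le:
  assumes "finite B" "B \<noteq> {}"
  shows "(\<Sum>z\<in>{z \<in> lists B. length z \<le> n}. (1 / real (card B)) ^ length z) = real n + 1"
proof (induction n)
  case 0
  have "{z \<in> lists B. length z \<le> 0} = {z \<in> lists B. length z = 0}" by auto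
  then show ?case using sum_words_length[OF assms, of 0] by simp
next
  case (Suc n)
  have eq: "{z \<in> lists B. length z \<le> Suc n}
      = {z \<in> lists B. length z \<le> n} \<union> {z \<in> lists B. length z = Suc n}" by auto
  have fin: "finite {z \<in> lists B. length z = Suc n}"
    by (rule finite_subset[OF _ finite_words_le[OF assms(1), of "Suc n"]]) auto
  show ?case unfolding eq
    using finite_words_le[OF assms(1)] fin Suc.IH sum_words_length[OF assms, of "Suc n"]
    by (subst sum.union_disjoint) auto
qed

text \<open>Weights multiply under concatenation, so expanding the power gives all sequences of
  \<open>r\<close> words of \<open>C\<close>; a word is counted once for each such
  factorization.\<close>

lemma sum_concat_power:
  fixes x :: real
  assumes "finite C"
  shows "(\<Sum>cs\<in>{cs. set cs \<subseteq> C \<and> length cs = r}. x ^ length (concat cs)) = (\<Sum>c\<in>C. x ^ length c) ^ r"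
proof (induction r)
  case 0
  have "{cs. set cs \<subseteq> C \<and> length cs = 0} = {[]}" by auto
  then show ?case by simp
next
  case (Suc r)
  have eq: "{cs. set cs \<subseteq> C \<and> length cs = Suc r} = (\<lambda>(c, cs). c # cs) ` (C \<times> {cs. set cs \<subseteq> C \<and> length cs = r})"
    by (auto simp: length_Suc_conv image_iff)
  have inj: "inj_on (\<lambda>(c, cs). c # cs) (C \<times> {cs. set cs \<subseteq> C \<and> length cs = r})"
    by (auto simp: inj_on_def)
  show ?case unfolding eq sum.reindex[OF inj]
    by (simp add: case_prod_unfold power_add Suc.IH[symmetric] sum_product sum.cartesian_product)
qed

text \<open>If \<open>s > 1\<close>, dividing by \<open>s ^ r\<close> makes the right-hand side tend
  to 0 while the left-hand side is 1.\<close>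

lemma power_le_linear_imp_le_one:
  fixes s :: real
  assumes "0 \<le> s" "\<And>r. s ^ r \<le> real r * n + 1"
  shows "s \<le> 1"
proof (rule ccontr)
  assume "\<not> s \<le> 1"
  then have s: "1 < s" by simp
  then have "(\<lambda>r. n * (real r * (1 / s) ^ r) + (1 / s) ^ r) \<longlonglongrightarrow> n * 0 + 0"
    by (intro tendsto_intros powser_times_n_limit_0 LIMSEQ_power_zero) auto
  then have "eventually (\<lambda>r. n * (real r * (1 / s) ^ r) + (1 / s) ^ r < 1) sequentially"
    by (rule order_tendstoD) simp
  then obtain r where "n * (real r * (1 / s) ^ r) + (1 / s) ^ r < 1"
    using eventually_happens'[OF sequentially_bot] by blast
  then show False using assms(2)[of r] s by (simp add: power_divide field_simps)
qed

text \<open>Injectivity of \<open>concat\<close> is unique decipherability: the \<open>r\<close>-th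
  power of the sum then counts distinct words, all of length at most \<open>r * n\<close>, so it
  grows at most linearly in \<open>r\<close>.\<close>

lemma kraft_mcmillan:
  assumes "finite B" "B \<noteq> {}" "finite C" "C \<subseteq> lists B" "inj_on concat (lists C)"
  shows "(\<Sum>c\<in>C. (1 / real (card B)) ^ length c) \<le> 1"
proof -
  define x where "x = 1 / real (card B)"
  \<comment> \<open>For empty \<open>C\<close> this maximum is unspecified; what matters is only
    that it bounds the lengths in \<open>C\<close>.\<close>
  define n where "n = Max (length ` C)"
  have n: "length c \<le> n" if "c \<in> C" for c using that assms(3) by (simp add: n_def)
  have "(\<Sum>c\<in>C. x ^ length c) ^ r \<le> real r * real n + 1" for r
  proof -
    let ?T = "{cs. set cs \<subseteq> C \<and> length cs = r}"
    have "?T \<subseteq> lists C" by auto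
    then have inj: "inj_on concat ?T" using assms(5) inj_on_subset by blast
    have len: "length (concat cs) \<le> length cs * n" if "set cs \<subseteq> C" for cs
      using that by (induction cs) (auto dest: n intro: add_mono)
    have sub: "concat ` ?T \<subseteq> {z \<in> lists B. length z \<le> r * n}"
      using assms(4) len by (fastforce simp: in_lists_conv_set)
    have "(\<Sum>c\<in>C. x ^ length c) ^ r = (\<Sum>z\<in>concat ` ?T. x ^ length z)"
      using sum_concat_power[OF assms(3)] inj by (simp add: sum.reindex)
    also have "\<dots> \<le> (\<Sum>z\<in>{z \<in> lists B. length z \<le> r * n}. x ^ length z)"
      by (intro sum_mono2 sub finite_words_le assms(1)) (simp add: x_def)
    also have "\<dots> = real r * real n + 1"
      unfolding x_def using sum_words_le[OF assms(1,2)] by simp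
    finally show ?thesis .
  qed
  moreover have "0 \<le> (\<Sum>c\<in>C. x ^ length c)" by (intro sum_nonneg) (simp add: x_def)
  ultimately show ?thesis using power_le_linear_imp_le_one unfolding x_def by blast
qed

section \<open>Complete submonoids with a thin set of generators\<close>

text \<open>Since \<open>w\<close> does not fit into one generator, a boundary between generators
  falls inside \<open>w\<close> or at one of its ends. The induction strips generators that end
  within \<open>u\<close>; the first one that goes beyond \<open>u\<close> ends within
  \<open>w\<close>.\<close>

lemma star_cut:
  assumes "w \<notin> factors X" "u @ w @ v \<in> star X"
  shows "\<exists>s p. w = s @ p \<and> u @ s \<in> star X \<and> p @ v \<in> star X"
proof -
  obtain xs where "xs \<in> lists X" "concat xs = u @ w @ v"
    using assms(2) unfolding star_def by (metis imageE)
  then show ?thesis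
  proof (induction xs arbitrary: u)
    case Nil
    then show ?case by (simp add: Nil_in_star)
  next
    case (Cons x xs)
    have x: "x \<in> X" and xs: "concat xs \<in> star X" using Cons.hyps by (auto simp: star_def)
    have eq: "x @ concat xs = u @ w @ v" using Cons.prems by simp
    show ?case
    proof (cases "length x \<le> length u")
      case True
      then obtain u' where u': "u = x @ u'" "concat xs = u' @ w @ v"
        using eq by (auto simp: append_eq_append_conv2)
      then obtain s p where "w = s @ p" "u' @ s \<in> star X" "p @ v \<in> star X" using Cons.IH by blast
      then show ?thesis using u' star_append[OF star_incl[OF x]] by auto
    next
      case False
      then obtain t where t: "x = u @ t" "t @ concat xs = w @ v"
        using eq by (auto simp: append_eq_append_conv2)
      have "\<not> prefix w t"
        using t(1) x assms(1) by (auto simp: prefix_def factors_def sublist_def)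
      then obtain p where "w = t @ p" "concat xs = p @ v"
        using t(2) by (auto simp: append_eq_append_conv2)
      then show ?thesis using t(1) xs star_incl[OF x] by auto
    qed
  qed
qed

text \<open>Density puts \<open>w @ z @ w\<close> inside an element of \<open>star X\<close>, and
  each copy of \<open>w\<close> can be cut. The range of \<open>i\<close> and \<open>j\<close> does
  not depend on \<open>z\<close>.\<close>

lemma star_completion:
  assumes "dense A (star X)" "w \<in> lists A" "w \<notin> factors X" "z \<in> lists A"
  shows "\<exists>i\<le>length w. \<exists>j\<le>length w. drop i w @ z @ take j w \<in> star X"
proof -
  have "w @ z @ w \<in> factors (star X)" using assms by (auto simp: dense_def)
  then obtain u v where "u @ w @ (z @ w @ v) \<in> star X" by (auto simp: factors_def sublist_def)
  then obtain s p where sp: "w = s @ p" "p @ z @ w @ v \<in> star X"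
    using star_cut[OF assms(3)] by blast
  from sp(2) have "(p @ z) @ w @ v \<in> star X" by simp
  then obtain s' p' where sp': "w = s' @ p'" "(p @ z) @ s' \<in> star X"
    using star_cut[OF assms(3)] by blast
  have "p = drop (length s) w" "length s \<le> length w" using sp(1) by auto
  moreover have "s' = take (length s') w" "length s' \<le> length w" using sp'(1) by auto
  ultimately show ?thesis using sp'(2) by (metis append_assoc)
qed

section \<open>Bounded weight of a free factor with nontrivial complement\<close>

lemma free_product_code:
  assumes "is_free_product N M L" "l \<in> L" "l \<noteq> []"
  shows "inj_on concat (lists ((\<lambda>m. m @ l) ` (M - {[]})))"
proof (rule inj_onI)
  let ?f = "\<lambda>m. m @ l" and ?g = "\<lambda>ms. concat (map (\<lambda>m. [m, l]) ms)"
  fix us vs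
  assume us: "us \<in> lists (?f ` (M - {[]}))" and vs: "vs \<in> lists (?f ` (M - {[]}))"
    and eq: "concat us = concat vs"
  from us vs obtain ms ns where ms: "ms \<in> lists (M - {[]})" "us = map ?f ms"
    and ns: "ns \<in> lists (M - {[]})" "vs = map ?f ns"
    by (auto simp: lists_image)
  \<comment> \<open>Splitting each \<open>m @ l\<close> into its two factors turns a product of such
    words into a reduced form; its uniqueness recovers the list of the \<open>m\<close>.\<close>
  have red: "reduced_form M L (?g ks) \<and> concat (?g ks) \<in> N \<and> concat (?g ks) = concat (map ?f ks)"
    if "ks \<in> lists (M - {[]})" for ks
  proof -
    have "alternating M L (?g ks)" using that assms(2,3) by (induction ks) auto
    moreover have "?g ks \<in> lists (M \<union> L)" using that assms(2) by (induction ks) auto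
    then have "concat (?g ks) \<in> N" using assms(1) by (simp add: is_free_product_def star_def)
    moreover have "concat (?g ks) = concat (map ?f ks)" by (induction ks) auto
    ultimately show ?thesis by (simp add: reduced_form_def)
  qed
  have "?g ms = ?g ns"
    using red[OF ms(1)] red[OF ns(1)] eq ms(2) ns(2) assms(1) unfolding is_free_product_def by metis
  then have "ms = ns"
  proof (induction ms arbitrary: ns)
    case Nil
    then show ?case by (cases ns) auto
  next
    case (Cons m ms)
    then show ?case by (cases ns) auto
  qed
  then show "us = vs" using ms ns by simp
qed

text \<open>By Kraft-McMillan the words \<open>m @ l\<close> with \<open>m\<close> nonempty weigh at
  most 1 in total; cancelling the weight of \<open>l\<close> gives the power of
  \<open>card B\<close>, and the summand 1 pays for the empty word.\<close>

lemma free_product_sum_bound: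
  assumes "is_free_product N M L" "l \<in> L" "l \<noteq> []" "finite B" "set l \<subseteq> B"
    and "finite S" "S \<subseteq> M \<inter> lists B"
  shows "(\<Sum>m\<in>S. (1 / real (card B)) ^ length m) \<le> 1 + real (card B) ^ length l"
proof -
  define x where "x = 1 / real (card B)"
  have B: "B \<noteq> {}" using assms(3,5) by auto
  then have x: "x > 0" "x ^ length l * real (card B) ^ length l = 1"
    using assms(4) by (auto simp: x_def card_gt_0_iff power_divide)
  let ?C = "(\<lambda>m. m @ l) ` (S - {[]})"
  have "set m \<subseteq> B" if "m \<in> S" for m using assms(7) that by auto
  then have sub: "?C \<subseteq> lists B" using assms(5) by fastforce
  have "inj_on concat (lists ?C)"
    by (rule inj_on_subset[OF free_product_code[OF assms(1-3)]]) (use assms(7) in \<open>auto intro!: lists_mono\<close>)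
  then have "(\<Sum>c\<in>?C. x ^ length c) \<le> 1" unfolding x_def
    by (intro kraft_mcmillan assms(4) B sub) (use assms(6) in auto)
  then have "(\<Sum>m\<in>S - {[]}. x ^ length m) * x ^ length l \<le> 1"
    by (simp add: sum.reindex inj_on_def power_add sum_distrib_right)
  then have "(\<Sum>m\<in>S - {[]}. x ^ length m) * x ^ length l * real (card B) ^ length l \<le> real (card B) ^ length l"
    using mult_right_mono[of _ 1 "real (card B) ^ length l"] by simp
  then have "(\<Sum>m\<in>S - {[]}. x ^ length m) \<le> real (card B) ^ length l"
    using x(2) by (simp add: mult.assoc)
  moreover have "(\<Sum>m\<in>S. x ^ length m) \<le> (\<Sum>m\<in>insert [] (S - {[]}). x ^ length m)"
    using assms(6) x(1) by (intro sum_mono2) auto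
  moreover have "(\<Sum>m\<in>insert [] (S - {[]}). x ^ length m) = 1 + (\<Sum>m\<in>S - {[]}. x ^ length m)"
    using assms(6) by (subst sum.insert) auto
  ultimately show ?thesis unfolding x_def by linarith
qed

section \<open>Unbounded weight of a complete submonoid\<close>

lemma sum_UN_le:
  fixes f :: "'a \<Rightarrow> real"
  assumes "finite I" "\<And>i. i \<in> I \<Longrightarrow> finite (D i)" "\<And>z. 0 \<le> f z"
  shows "sum f (\<Union>i\<in>I. D i) \<le> (\<Sum>i\<in>I. sum f (D i))"
  using assms(1,2)
proof (induction I)
  case empty
  then show ?case by simp
next
  case (insert i I)
  let ?U = "\<Union>i\<in>I. D i"
  have "sum f (D i \<union> ?U) + sum f (D i \<inter> ?U) = sum f (D i) + sum f ?U"
    using insert by (intro sum.union_inter) auto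
  moreover have "0 \<le> sum f (D i \<inter> ?U)" using assms(3) by (intro sum_nonneg)
  ultimately show ?case using insert by simp
qed

text \<open>The words over \<open>B\<close> of length at most \<open>n\<close> weigh
  \<open>n + 1\<close> in total. Completing them to elements of \<open>star X\<close> loses at most
  a constant factor \<open>c\<close>, so large \<open>n\<close> exceeds any bound
  \<open>K\<close>.\<close>

lemma complete_sum_unbounded:
  assumes "dense A (star X)" "w \<notin> factors X" "finite B" "B \<noteq> {}" "B \<subseteq> A" "set w \<subseteq> B"
  shows "\<exists>S. finite S \<and> S \<subseteq> star X \<inter> lists B \<and> K < (\<Sum>m\<in>S. (1 / real (card B)) ^ length m)"
proof -
  define x where "x = 1 / real (card B)"
  have q: "real (card B) \<ge> 1" using assms(3,4) by (simp add: card_gt_0_iff Suc_le_eq)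
  then have x: "0 < x" "x \<le> 1" by (auto simp: x_def)
  \<comment> \<open>The numerator counts the pairs \<open>(i, j)\<close>; a completion adds at most
    \<open>2 * length w\<close> letters, which multiplies the weight by at least
    \<open>x ^ (2 * length w)\<close>.\<close>
  define c where "c = (real (Suc (length w)))\<^sup>2 / x ^ (2 * length w)"
  have c: "c > 0" using x by (simp add: c_def)
  obtain n :: nat where n: "K * c < real n" using reals_Archimedean2 by blast
  let ?W = "{z \<in> lists B. length z \<le> n}"
  let ?S = "{m \<in> star X \<inter> lists B. length m \<le> n + 2 * length w}"
  let ?I = "{..length w} \<times> {..length w}"
  let ?D = "\<lambda>(i, j). {z \<in> ?W. drop i w @ z @ take j w \<in> star X}"
  have finS: "finite ?S"
    by (rule finite_subset[OF _ finite_words_le[OF assms(3), of "n + 2 * length w"]]) auto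
  have finD: "finite (?D ij)" for ij
    by (rule finite_subset[OF _ finite_words_le[OF assms(3), of n]]) (auto split: prod.splits)
  have w: "w \<in> lists A" using assms(5,6) by auto
  have cover: "?W \<subseteq> (\<Union>ij\<in>?I. ?D ij)"
  proof
    fix z assume z: "z \<in> ?W"
    then have "z \<in> lists A" using assms(5) by auto
    then show "z \<in> (\<Union>ij\<in>?I. ?D ij)"
      using star_completion[OF assms(1) w assms(2), of z] z by auto
  qed
  \<comment> \<open>For a fixed pair the added ends are fixed, so completion is injective on
    \<open>?D ij\<close> and maps it into \<open>?S\<close>.\<close>
  have part: "(\<Sum>z\<in>?D ij. x ^ length z) \<le> (\<Sum>m\<in>?S. x ^ length m) / x ^ (2 * length w)" if "ij \<in> ?I" for ij
  proof -
    obtain i j where ij: "ij = (i, j)" "i \<le> length w" "j \<le> length w" using \<open>ij \<in> ?I\<close> by auto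
    let ?f = "\<lambda>z. drop i w @ z @ take j w"
    have dt: "set (drop i w) \<subseteq> B" "set (take j w) \<subseteq> B"
      using assms(6) set_drop_subset set_take_subset by fast+
    have img: "?f ` ?D ij \<subseteq> ?S" using ij dt by (auto simp: in_lists_conv_set)
    have inj: "inj_on ?f (?D ij)" by (auto simp: inj_on_def)
    have "(\<Sum>z\<in>?D ij. x ^ length z) * x ^ (2 * length w) = (\<Sum>z\<in>?D ij. x ^ (length z + 2 * length w))"
      by (simp add: sum_distrib_right power_add)
    also have "\<dots> \<le> (\<Sum>z\<in>?D ij. x ^ length (?f z))"
      using x ij by (intro sum_mono power_decreasing) auto
    also have "\<dots> = (\<Sum>m\<in>?f ` ?D ij. x ^ length m)" by (subst sum.reindex[OF inj]) simp
    also have "\<dots> \<le> (\<Sum>m\<in>?S. x ^ length m)"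
      using x by (intro sum_mono2[OF finS img]) simp
    finally show ?thesis using x by (simp add: pos_le_divide_eq)
  qed
  have "real n + 1 = (\<Sum>z\<in>?W. x ^ length z)"
    unfolding x_def using sum_words_le[OF assms(3,4)] by simp
  also have "\<dots> \<le> (\<Sum>z\<in>(\<Union>ij\<in>?I. ?D ij). x ^ length z)"
    using x finD by (intro sum_mono2 cover) auto
  also have "\<dots> \<le> (\<Sum>ij\<in>?I. \<Sum>z\<in>?D ij. x ^ length z)"
    using x finD by (intro sum_UN_le) auto
  also have "\<dots> \<le> (\<Sum>ij\<in>?I. (\<Sum>m\<in>?S. x ^ length m) / x ^ (2 * length w))"
    by (intro sum_mono part)
  also have "\<dots> = c * (\<Sum>m\<in>?S. x ^ length m)"
    by (simp add: c_def power2_eq_square field_simps)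
  finally have "K * c < (\<Sum>m\<in>?S. x ^ length m) * c" using n by (simp add: mult.commute)
  then have "K < (\<Sum>m\<in>?S. x ^ length m)" using c by simp
  then show ?thesis using finS unfolding x_def by blast
qed

lemma complete_imp_full:
  assumes "X \<subseteq> lists A" "thin A X" "dense A (star X)"
  shows "full A (star X)"
  unfolding full_def
proof (intro conjI allI impI)
  show M: "submonoid_of A (star X)" using submonoid_of_star assms(1) .
  fix N assume "free_factor A (star X) N"
  then obtain L where L: "submonoid_of A L" "is_free_product N (star X) L"
    by (auto simp: free_factor_def)
  have "L = {[]}"
  proof (rule ccontr)
    assume "L \<noteq> {[]}"
    then obtain l where l: "l \<in> L" "l \<noteq> []" using L(1) by (auto simp: submonoid_of_def)
    have "factors X \<subseteq> lists A" using assms(1) by (auto simp: factors_def dest!: set_mono_sublist)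
    then obtain w where w: "w \<in> lists A" "w \<notin> factors X"
      using assms(2) by (auto simp: thin_def dense_def)
    \<comment> \<open>The letters of \<open>w\<close> keep completions over \<open>B\<close>, those
      of \<open>l\<close> keep the words \<open>m @ l\<close> over \<open>B\<close>; and
      \<open>B\<close> is finite even if \<open>A\<close> is not.\<close>
    define B where "B = set w \<union> set l"
    have B: "finite B" "B \<noteq> {}" "B \<subseteq> A" "set w \<subseteq> B" "set l \<subseteq> B"
      using w(1) l L(1) by (auto simp: B_def submonoid_of_def)
    show False
      using complete_sum_unbounded[OF assms(3) w(2) B(1-4), of "1 + real (card B) ^ length l"]
        free_product_sum_bound[OF L(2) l B(1,5)] by (metis not_less)
  qed
  then have "star X \<union> L = star X" using M by (auto simp: submonoid_of_def)
  then show "N = star X" using L(2) star_submonoid[OF M] by (simp add: is_free_product_def)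
qed

theorem theorem4p19:
  fixes A :: "'a set" and X :: "'a list set"
  assumes "code A X" and "thin A X"
  shows "complete A X \<longleftrightarrow> maximal_code A X"
proof
  assume "complete A X"
  then have "full A (star X)"
    using complete_imp_full[of X A] assms by (auto simp: code_def complete_def)
  then show "maximal_code A X" using assms(1) by (simp add: maximal_code_def)
next
  assume "maximal_code A X"
  then show "complete A X" using full_imp_dense by (auto simp: maximal_code_def complete_def)
qed

end
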